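(* For any non-integer $\beta>1$, and for $\lambda$-a.e. $x\in J_\beta$, there exist $2^{\aleph_0}$ universal expansions of $x$ in base $\beta$.
   Context: $J_\beta=[0,\lfloor\beta\rfloor/(\beta-1)]$ and $\lambda$ is the normalized Lebesgue measure on $J_\beta$. An expansion of $x\in J_\beta$ in base $\beta$ is a sequence $(d_1,d_2,\ldots)$ with $d_i\in\{0,1,\ldots,\lfloor\beta\rfloor\}$ and $x=\sum_{i=1}^\infty d_i\beta^{-i}$. The expansion is called universal if for each finite block $b_1\ldots b_n$ of digits in $\{0,\ldots,\lfloor\beta\rfloor\}$ there exists an index $k\ge1$ such that $d_k\ldots d_{k+n-1}=b_1\ldots b_n$. *)

theory Defs
  imports "HOL-Analysis.Analysis" "HOL-Library.Equipollence"
begin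

definition expansion_interval :: "real \<Rightarrow> real set" where
  "expansion_interval \<beta> = {0 .. of_int \<lfloor>\<beta>\<rfloor> / (\<beta> - 1)}"

definition normalized_lebesgue :: "real \<Rightarrow> real measure" where
  "normalized_lebesgue \<beta> =
     uniform_measure (lebesgue_on (expansion_interval \<beta>)) (expansion_interval \<beta>)"

definition digits :: "real \<Rightarrow> int set" where
  "digits \<beta> = {0 .. \<lfloor>\<beta>\<rfloor>}"

text \<open>Digit sequences are indexed from 0: the value \<open>d i\<close> is the digit \<open>d\<^sub>i\<^sub>+\<^sub>1\<close>
  of the sequence \<open>d\<^sub>1, d\<^sub>2, \<dots>\<close>, so that its weight is \<open>\<beta>\<close> to the power \<open>-(i + 1)\<close>.\<close>

definition is_expansion :: "real \<Rightarrow> real \<Rightarrow> (nat \<Rightarrow> int) \<Rightarrow> bool" where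
  "is_expansion \<beta> x d \<longleftrightarrow>
     (\<forall>i. d i \<in> digits \<beta>) \<and> (\<lambda>i. of_int (d i) / \<beta> ^ (i + 1)) sums x"

definition universal :: "real \<Rightarrow> (nat \<Rightarrow> int) \<Rightarrow> bool" where
  "universal \<beta> d \<longleftrightarrow>
     (\<forall>b. set b \<subseteq> digits \<beta> \<longrightarrow> (\<exists>k. \<forall>j<length b. d (k + j) = b ! j))"

end

theory Submission
  imports Defs
begin

text \<open>Consider the branches \<open>y \<mapsto> \<beta> y - d\<close>, with \<open>d\<close> a digit; a word is admissible at \<open>x\<close> if the
  branches along it keep \<open>x\<close> in the expansion interval. For a fixed block \<open>b\<close>, the points from which
  no admissible word ends in \<open>b\<close> form a porous set, hence a null set. So from almost every \<open>x\<close>,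
  whatever admissible word has been read, every block can still be reached. In particular the orbit
  can always be steered into the interval where both digits 0 and 1 are possible. Alternating
  between the next block of an enumeration and such a free binary choice gives an injection from
  the subsets of the naturals into the universal expansions of \<open>x\<close>.\<close>

section \<open>Null sets from porosity\<close>

text \<open>By the Vitali covering theorem, \<open>Z\<close> is covered, up to a null set, by disjoint balls inside an
  open set \<open>U\<close> that exceeds \<open>Z\<close> by less than \<open>e\<close>; the holes of these balls lie in \<open>U - Z\<close>.\<close>

lemma negligible_if_porous:
  fixes Z :: "'a::euclidean_space set" and c :: real
  assumes Z: "Z \<in> sets lebesgue" and c: "0 < c"
    and porous: "\<And>x e. x \<in> Z \<Longrightarrow> 0 < e \<Longrightarrow>
      \<exists>a r G. 0 < r \<and> r < e \<and> x \<in> cball a r \<and> G \<in> sets lebesgue \<and> G \<subseteq> cball a r - Z \<and>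
        ennreal c * emeasure lebesgue (cball a r) \<le> emeasure lebesgue G"
  shows "negligible Z"
proof -
  have bound: "ennreal c * emeasure lebesgue Z \<le> ennreal e" if e: "0 < e" for e
  proof -
    obtain U where U: "open U" "Z \<subseteq> U" "U - Z \<in> lmeasurable" "emeasure lebesgue (U - Z) < ennreal e"
      using sets_lebesgue_outer_open[OF Z e] by metis
    \<comment> \<open>The hole travels with its ball as part of the index, so the disjoint subfamily
      selected by the covering theorem comes with its holes.\<close>
    define K where "K = {(a, r, G). 0 < r \<and> cball a r \<subseteq> U \<and> G \<in> sets lebesgue \<and>
       G \<subseteq> cball a r - Z \<and> ennreal c * emeasure lebesgue (cball a r) \<le> emeasure lebesgue G}"
    define B where "B = (\<lambda>i :: 'a \<times> real \<times> 'a set. cball (fst i) (fst (snd i)))"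
    define G where "G = (\<lambda>i :: 'a \<times> real \<times> 'a set. snd (snd i))"
    have K: "0 < fst (snd i)" "B i \<subseteq> U" "G i \<in> sets lebesgue" "G i \<subseteq> B i - Z"
      "ennreal c * emeasure lebesgue (B i) \<le> emeasure lebesgue (G i)" if "i \<in> K" for i
      using that by (auto simp: K_def B_def G_def)
    have cov: "\<exists>i. i \<in> K \<and> x \<in> cball (fst i) (fst (snd i)) \<and> fst (snd i) < d"
      if x: "x \<in> Z" and d: "0 < d" for x d
    proof -
      obtain \<delta> where \<delta>: "\<delta> > 0" "ball x \<delta> \<subseteq> U"
        using U x open_contains_ball by blast
      \<comment> \<open>The ball contains \<open>x\<close> but need not be centred there; a diameter
        below \<delta> still keeps it inside \<open>ball x \<delta>\<close>.\<close>
      obtain a r H where aH: "0 < r" "r < min d (\<delta> / 2)" "x \<in> cball a r" "H \<in> sets lebesgue"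
        "H \<subseteq> cball a r - Z" "ennreal c * emeasure lebesgue (cball a r) \<le> emeasure lebesgue H"
        using porous[OF x, of "min d (\<delta> / 2)"] d \<delta> by auto
      have "cball a r \<subseteq> ball x \<delta>"
      proof
        fix y assume "y \<in> cball a r"
        then have "dist x y \<le> r + r"
          using aH(3) dist_triangle3[of x y a] by simp
        then show "y \<in> ball x \<delta>" using aH(2) by simp
      qed
      with \<delta> aH have "(a, r, H) \<in> K" by (auto simp: K_def)
      with aH show ?thesis by force
    qed
    obtain C where C: "countable C" "C \<subseteq> K"
      "pairwise (\<lambda>i j. disjnt (cball (fst i) (fst (snd i))) (cball (fst j) (fst (snd j)))) C"
      "negligible (Z - (\<Union>i\<in>C. cball (fst i) (fst (snd i))))"
      by (rule Vitali_covering_theorem_cballs[of K "\<lambda>i. fst (snd i)" Z fst, OF K(1) cov])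
    have disj: "disjoint_family_on B C" "disjoint_family_on G C"
      using C(2,3) K(4) unfolding disjoint_family_on_def pairwise_def disjnt_def B_def
      by blast+
    have Bm: "B i \<in> sets lebesgue" for i by (simp add: B_def)
    have UB: "(\<Union>i\<in>C. B i) \<in> sets lebesgue"
      using C(1) Bm by (intro sets.countable_UN') auto
    have null: "Z - (\<Union>i\<in>C. B i) \<in> null_sets lebesgue"
      using C(4) by (simp add: B_def negligible_iff_null_sets)
    have "emeasure lebesgue Z \<le> emeasure lebesgue ((\<Union>i\<in>C. B i) \<union> (Z - (\<Union>i\<in>C. B i)))"
      using UB Z by (intro emeasure_mono) auto
    also have "\<dots> = emeasure lebesgue (\<Union>i\<in>C. B i)"
      using UB null by (rule emeasure_Un_null_set)
    also have "\<dots> = (\<integral>\<^sup>+i. emeasure lebesgue (B i) \<partial>count_space C)"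
      using C(1) Bm disj(1) by (intro emeasure_UN_countable) auto
    finally have "ennreal c * emeasure lebesgue Z
        \<le> ennreal c * (\<integral>\<^sup>+i. emeasure lebesgue (B i) \<partial>count_space C)"
      by (rule mult_left_mono) simp
    also have "\<dots> = (\<integral>\<^sup>+i. ennreal c * emeasure lebesgue (B i) \<partial>count_space C)"
      by (simp add: nn_integral_cmult)
    also have "\<dots> \<le> (\<integral>\<^sup>+i. emeasure lebesgue (G i) \<partial>count_space C)"
      using C(2) K(5) by (intro nn_integral_mono) auto
    also have "\<dots> = emeasure lebesgue (\<Union>i\<in>C. G i)"
      using C(1,2) K(3) disj(2) by (intro emeasure_UN_countable[symmetric]) auto
    also have "\<dots> \<le> emeasure lebesgue (U - Z)"
    proof (rule emeasure_mono)
      show "(\<Union>i\<in>C. G i) \<subseteq> U - Z" using C(2) K(2,4) by blast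
      show "U - Z \<in> sets lebesgue" using U(3) by (rule fmeasurableD)
    qed
    also have "\<dots> \<le> ennreal e" using U(4) by simp
    finally show ?thesis .
  qed
  have "ennreal c * emeasure lebesgue Z \<le> 0"
  proof (rule ennreal_le_epsilon)
    fix e :: real assume "0 < e"
    then show "ennreal c * emeasure lebesgue Z \<le> 0 + ennreal e" using bound by simp
  qed
  then have "emeasure lebesgue Z = 0"
    using c by (auto simp: ennreal_mult_eq_top_iff)
  then show ?thesis
    using Z by (simp add: negligible_iff_null_sets null_sets_def)
qed

section \<open>Continuum many sequences from a branching tree of words\<close>

text \<open>Stage \<open>n\<close> extends the current word by a detour through the
  \<open>n\<close>-th block and then by one letter recording whether \<open>n\<close> lies in a
  given set. The limit sequence meets every block, and its branching letters give the set back. Good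
  prefixes are obtained only at the ends of stages, hence at infinitely many lengths.\<close>

lemma branching_words_lepoll:
  fixes good :: "'a::countable list \<Rightarrow> bool" and D :: "'a set"
  assumes "a0 \<noteq> a1" and nil: "good []"
    and branch: "\<And>w b. good w \<Longrightarrow> set b \<subseteq> D \<Longrightarrow>
      \<exists>u v. good (w @ u @ b @ v @ [a0]) \<and> good (w @ u @ b @ v @ [a1])"
  shows "(UNIV :: nat set set) \<lesssim>
    {d. (\<forall>n. \<exists>m\<ge>n. good (map d [0..<m])) \<and>
        (\<forall>b. set b \<subseteq> D \<longrightarrow> (\<exists>k. \<forall>j<length b. d (k + j) = b ! j))}"
    (is "_ \<lesssim> ?E")
proof -
  \<comment> \<open>\<open>from_nat\<close> enumerates all lists; those not over \<open>D\<close>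
    default to the empty block, so that \<open>branch\<close> applies at every stage.\<close>
  define block :: "nat \<Rightarrow> 'a list"
    where "block n = (if set (from_nat n :: 'a list) \<subseteq> D then from_nat n else [])" for n
  have block: "set (block n) \<subseteq> D" for n by (auto simp: block_def)
  have "\<forall>w n. \<exists>u v. good w \<longrightarrow>
      good (w @ u @ block n @ v @ [a0]) \<and> good (w @ u @ block n @ v @ [a1])"
    using branch block by meson
  then obtain u v where uv: "\<And>w n. good w \<Longrightarrow> good (w @ u w n @ block n @ v w n @ [a0])"
      "\<And>w n. good w \<Longrightarrow> good (w @ u w n @ block n @ v w n @ [a1])"
    by metis
  define p where "p w n = u w n @ block n @ v w n" for w n
  define W where "W C = rec_nat [] (\<lambda>n w. w @ p w n @ [if n \<in> C then a1 else a0])" for C :: "nat set"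
  have W_0: "W C 0 = []" and
    W_Suc: "W C (Suc n) = W C n @ p (W C n) n @ [if n \<in> C then a1 else a0]" for C n
    by (simp_all add: W_def)
  have good_W: "good (W C n)" for C n
    by (induction n) (use nil uv in \<open>auto simp: W_0 W_Suc p_def\<close>)
  have len_W: "n \<le> length (W C n)" for C n
    by (induction n) (auto simp: W_Suc)
  have W_mono: "\<exists>t. W C (n + m) = W C n @ t" for C n m
    by (induction m) (auto simp: W_Suc)
  \<comment> \<open>Every stage adds at least the branching letter, so stage \<open>Suc i\<close> is
    longer than \<open>i\<close> and already fixes position \<open>i\<close>.\<close>
  define d where "d C i = W C (Suc i) ! i" for C i
  have W_nth: "W C n ! i = d C i" if i: "i < length (W C n)" for C n i
  proof -
    have "i < length (W C (Suc i))" using len_W[of "Suc i" C] by simp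
    moreover obtain s t where "W C (n + Suc i) = W C n @ s" "W C (Suc i + n) = W C (Suc i) @ t"
      using W_mono by metis
    ultimately show ?thesis
      unfolding d_def using i by (metis add.commute nth_append)
  qed
  have d_W: "map (d C) [0..<length (W C n)] = W C n" for C n
    by (rule nth_equalityI) (auto simp: W_nth)
  have "d C \<in> ?E" for C
  proof (intro CollectI conjI allI impI)
    show "\<exists>m\<ge>n. good (map (d C) [0..<m])" for n
      using d_W good_W len_W by metis
  next
    fix b :: "'a list" assume b: "set b \<subseteq> D"
    define n where "n = to_nat b"
    have bn: "block n = b" using b by (simp add: block_def n_def)
    let ?w = "W C n"
    let ?k = "length ?w + length (u ?w n)"
    have "d C (?k + j) = b ! j" if j: "j < length b" for j
    proof -
      have "?k + j < length (W C (Suc n))" using j by (simp add: W_Suc p_def bn)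
      then have "d C (?k + j) = W C (Suc n) ! (?k + j)" by (simp add: W_nth)
      also have "\<dots> = b ! j" using j by (simp add: W_Suc p_def bn nth_append)
      finally show ?thesis .
    qed
    then show "\<exists>k. \<forall>j<length b. d C (k + j) = b ! j" by blast
  qed
  moreover have "inj d"
  proof (rule injI)
    fix A B assume eq: "d A = d B"
    \<comment> \<open>The inserted part \<open>p\<close> depends only on the current word and on
      \<open>n\<close>. Equal words therefore put their branching letter at the same position
      \<open>?i\<close>, where \<open>d A = d B\<close> forces agreement about
      \<open>n\<close>.\<close>
    have "W A n = W B n \<and> (\<forall>k<n. k \<in> A \<longleftrightarrow> k \<in> B)" for n
    proof (induction n)
      case (Suc n)
      then have WW: "W A n = W B n" by simp
      let ?i = "length (W A n) + length (p (W A n) n)"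
      have "W A (Suc n) ! ?i = d A ?i" "W B (Suc n) ! ?i = d B ?i"
        by (rule W_nth, simp add: W_Suc WW)+
      moreover have "W A (Suc n) ! ?i = (if n \<in> A then a1 else a0)"
        "W B (Suc n) ! ?i = (if n \<in> B then a1 else a0)"
        by (simp_all add: W_Suc WW nth_append)
      ultimately have "n \<in> A \<longleftrightarrow> n \<in> B"
        using eq \<open>a0 \<noteq> a1\<close> by (auto split: if_splits)
      with Suc show ?case by (auto simp: W_Suc less_Suc_eq)
    qed (simp add: W_0)
    then show "A = B" by blast
  qed
  ultimately show ?thesis
    unfolding lepoll_def by blast
qed

text \<open>Upper bound for the number of digit sequences: a function is recovered from its graph,
  whose pairs are coded as naturals.\<close>

lemma nat_fun_lepoll_nat_sets: "(UNIV :: (nat \<Rightarrow> 'a::countable) set) \<lesssim> (UNIV :: nat set set)"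
proof -
  define g :: "(nat \<Rightarrow> 'a) \<Rightarrow> nat set" where "g f = {to_nat (i, f i) | i. True}" for f
  have "inj g"
  proof (rule injI)
    fix f h assume eq: "g f = g h"
    have "f i = h i" for i
    proof -
      have "to_nat (i, f i) \<in> g h" unfolding eq[symmetric] by (auto simp: g_def)
      then obtain k where "to_nat (i, f i) = to_nat (k, h k)" by (auto simp: g_def)
      then show ?thesis by auto
    qed
    then show "f = h" by blast
  qed
  then show ?thesis unfolding lepoll_def by blast
qed

section \<open>Orbits under digit words and rich points\<close>

text \<open>This is the remainder that the partial expansion with digits \<open>w\<close> leaves of
  \<open>x\<close>, magnified by \<open>\<beta> ^ length w\<close>; see
  \<open>orbit_map_upt\<close>.\<close>

definition orbit :: "real \<Rightarrow> real \<Rightarrow> int list \<Rightarrow> real" where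
  "orbit \<beta> x w = foldl (\<lambda>y d. \<beta> * y - of_int d) x w"

lemma orbit_Nil [simp]: "orbit \<beta> x [] = x"
  and orbit_Cons [simp]: "orbit \<beta> x (d # w) = orbit \<beta> (\<beta> * x - of_int d) w"
  and orbit_append: "orbit \<beta> x (v @ w) = orbit \<beta> (orbit \<beta> x v) w"
  by (simp_all add: orbit_def)

lemma orbit_affine: "orbit \<beta> x w = \<beta> ^ length w * x + orbit \<beta> 0 w"
  by (induction w rule: rev_induct) (simp_all add: orbit_append algebra_simps)

lemma orbit_map_upt:
  assumes "\<beta> \<noteq> 0"
  shows "(\<Sum>i<n. of_int (d i) / \<beta> ^ (i + 1)) = x - orbit \<beta> x (map d [0..<n]) / \<beta> ^ n"
  using assms by (induction n) (simp_all add: orbit_append diff_divide_distrib)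

text \<open>Quantifying over every admissible \<open>v\<close>, and not just the empty word, lets
  the property pass to all later orbit points (\<open>rich_orbit\<close>), so that steering can be
  iterated. Only the ends of words are tested; \<open>orbit_prefix_mem\<close> supplies the points
  in between.\<close>

definition rich :: "real \<Rightarrow> real \<Rightarrow> bool" where
  "rich \<beta> x \<longleftrightarrow> x \<in> expansion_interval \<beta> \<and>
     (\<forall>v\<in>lists (digits \<beta>). \<forall>b\<in>lists (digits \<beta>). orbit \<beta> x v \<in> expansion_interval \<beta> \<longrightarrow>
       (\<exists>w\<in>lists (digits \<beta>). orbit \<beta> x (v @ w @ b) \<in> expansion_interval \<beta>))"

lemma rich_orbit:
  assumes "rich \<beta> x" "v \<in> lists (digits \<beta>)" "orbit \<beta> x v \<in> expansion_interval \<beta>"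
  shows "rich \<beta> (orbit \<beta> x v)"
  unfolding rich_def
proof (intro conjI ballI impI)
  fix u b
  assume u: "u \<in> lists (digits \<beta>)" "b \<in> lists (digits \<beta>)"
    "orbit \<beta> (orbit \<beta> x v) u \<in> expansion_interval \<beta>"
  then have "v @ u \<in> lists (digits \<beta>)" "orbit \<beta> x (v @ u) \<in> expansion_interval \<beta>"
    using assms(2) by (auto simp: orbit_append)
  with assms(1) u(2) obtain w where "w \<in> lists (digits \<beta>)"
    "orbit \<beta> x ((v @ u) @ w @ b) \<in> expansion_interval \<beta>"
    unfolding rich_def by blast
  then show "\<exists>w\<in>lists (digits \<beta>). orbit \<beta> (orbit \<beta> x v) (u @ w @ b) \<in> expansion_interval \<beta>"
    by (auto simp: orbit_append)
qed (use assms in auto)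

lemma countable_lists_digits: "countable (lists (digits \<beta>))"
  by (rule countable_lists) simp

section \<open>Admissible digits on the expansion interval\<close>

context
  fixes \<beta> :: real
  assumes \<beta>: "\<beta> > 1"
begin

definition len :: real where "len = of_int \<lfloor>\<beta>\<rfloor> / (\<beta> - 1)"

lemma expansion_interval_eq: "expansion_interval \<beta> = {0..len}"
  by (simp add: expansion_interval_def len_def)

lemma len_gt_1: "1 < len"
  unfolding len_def using \<beta> by (simp add: field_simps) linarith

text \<open>The right endpoint is the fixed point of the branch with the largest digit, as 0 is for
  the digit 0.\<close>

lemma len_eq: "\<beta> * len = len + of_int \<lfloor>\<beta>\<rfloor>"
  unfolding len_def using \<beta> by (simp add: field_simps)

lemma digits_0_1: "0 \<in> digits \<beta>" "1 \<in> digits \<beta>"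
  using \<beta> by (auto simp: digits_def le_floor_iff)

text \<open>No branch leads back into the interval: a negative point stays negative, and a point
  beyond \<open>len\<close> stays beyond it by \<open>len_eq\<close>.\<close>

lemma orbit_prefix_mem:
  assumes "w \<in> lists (digits \<beta>)" "orbit \<beta> x w \<in> expansion_interval \<beta>"
  shows "x \<in> expansion_interval \<beta>"
  using assms
proof (induction w arbitrary: x)
  case (Cons d w)
  have "d \<in> digits \<beta>" using Cons.hyps(1) .
  then have d: "0 \<le> d" "d \<le> \<lfloor>\<beta>\<rfloor>" by (simp_all add: digits_def)
  have "\<beta> * x - of_int d \<in> expansion_interval \<beta>"
    using Cons by simp
  then have *: "of_int d \<le> \<beta> * x" "\<beta> * x \<le> len + of_int d"
    by (auto simp: expansion_interval_eq)
  have "0 \<le> \<beta> * x" using * d by linarith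
  moreover have "\<beta> * x \<le> \<beta> * len" using * d unfolding len_eq by linarith
  ultimately show ?case using \<beta> by (simp add: expansion_interval_eq zero_le_mult_iff)
qed simp

text \<open>The greedy choice works: take the integer part of \<open>\<beta> * x\<close>, capped at
  the largest digit. Without the cap the remainder is below 1, hence below \<open>len\<close>; with
  the cap it is bounded through \<open>len_eq\<close>.\<close>

lemma exists_next_digit:
  assumes "x \<in> expansion_interval \<beta>"
  shows "\<exists>d\<in>digits \<beta>. \<beta> * x - of_int d \<in> expansion_interval \<beta>"
proof -
  have x: "0 \<le> x" "x \<le> len" using assms by (auto simp: expansion_interval_eq)
  have bx: "0 \<le> \<beta> * x" "\<beta> * x \<le> len + of_int \<lfloor>\<beta>\<rfloor>"
    using x \<beta> by (simp, metis len_eq mult_left_mono less_imp_le order_trans zero_less_one)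
  show ?thesis
  proof (cases "\<lfloor>\<beta> * x\<rfloor> \<le> \<lfloor>\<beta>\<rfloor>")
    case True
    have "\<beta> * x - of_int \<lfloor>\<beta> * x\<rfloor> \<in> expansion_interval \<beta>"
      unfolding expansion_interval_eq using len_gt_1 by simp linarith
    with True bx show ?thesis by (auto simp: digits_def intro!: bexI[of _ "\<lfloor>\<beta> * x\<rfloor>"])
  next
    case False
    then have "of_int \<lfloor>\<beta>\<rfloor> \<le> \<beta> * x" by linarith
    then show ?thesis using bx \<beta>
      by (intro bexI[of _ "\<lfloor>\<beta>\<rfloor>"]) (auto simp: digits_def expansion_interval_eq)
  qed
qed

lemma exists_orbit_word:
  assumes "x \<in> expansion_interval \<beta>"
  shows "\<exists>w\<in>lists (digits \<beta>). length w = n \<and> orbit \<beta> x w \<in> expansion_interval \<beta>"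
proof (induction n)
  case 0
  then show ?case using assms by (intro bexI[of _ "[]"]) auto
next
  case (Suc n)
  then obtain w where w: "w \<in> lists (digits \<beta>)" "length w = n"
    "orbit \<beta> x w \<in> expansion_interval \<beta>" by blast
  then obtain d where "d \<in> digits \<beta>" "\<beta> * orbit \<beta> x w - of_int d \<in> expansion_interval \<beta>"
    using exists_next_digit by blast
  with w show ?case by (intro bexI[of _ "w @ [d]"]) (auto simp: orbit_append)
qed

section \<open>Cylinders and the null set of non-rich points\<close>

lemma exists_small_scale:
  assumes "0 < e"
  shows "\<exists>n. K / \<beta> ^ n < e"
proof -
  obtain n where "K / e < \<beta> ^ n" using real_arch_pow[OF \<beta>] by blast
  then show ?thesis using assms \<beta> by (intro exI[of _ n]) (simp add: field_simps)
qed

text \<open>The orbit is affine in its starting point with positive slope, so a cylinder is an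
  interval; the ball form is the one that \<open>negligible_if_porous\<close> expects.\<close>

lemma cylinder_eq_cball:
  "{y. orbit \<beta> y w \<in> expansion_interval \<beta>} =
     cball ((len / 2 - orbit \<beta> 0 w) / \<beta> ^ length w) (len / 2 / \<beta> ^ length w)"
proof -
  have p: "0 < \<beta> ^ length w" using \<beta> by simp
  have iff: "0 \<le> q * y + k \<and> q * y + k \<le> len \<longleftrightarrow>
      (len / 2 - k) / q - len / 2 / q \<le> y \<and> y \<le> (len / 2 - k) / q + len / 2 / q"
    if "0 < q" for q k y :: real
  proof -
    have "(len / 2 - k) / q - len / 2 / q = - k / q" "(len / 2 - k) / q + len / 2 / q = (len - k) / q"
      using that by (simp_all add: field_simps)
    moreover have "0 \<le> q * y + k \<longleftrightarrow> - k / q \<le> y" "q * y + k \<le> len \<longleftrightarrow> y \<le> (len - k) / q"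
      using that by (auto simp: pos_le_divide_eq pos_divide_le_eq mult.commute
          simp del: divide_minus_left)
    ultimately show ?thesis by simp
  qed
  show ?thesis
    unfolding cball_eq_atLeastAtMost expansion_interval_eq
    by (subst orbit_affine) (simp add: set_eq_iff iff[OF p])
qed

lemma emeasure_cylinder:
  "emeasure lebesgue {y. orbit \<beta> y w \<in> expansion_interval \<beta>} = ennreal (len / \<beta> ^ length w)"
proof -
  have "0 \<le> len / 2 / \<beta> ^ length w" using len_gt_1 \<beta> by simp
  then show ?thesis
    unfolding cylinder_eq_cball cball_eq_atLeastAtMost by simp
qed

definition avoiding :: "int list \<Rightarrow> real set" where
  "avoiding b = {x \<in> expansion_interval \<beta>.
     \<forall>w\<in>lists (digits \<beta>). orbit \<beta> x (w @ b) \<notin> expansion_interval \<beta>}"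

text \<open>A cylinder of \<open>w\<close> contains the cylinder of \<open>w @ b\<close>, which misses \<open>avoiding b\<close> and occupies
  the proportion \<open>\<beta>\<close> to the power \<open>- length b\<close>, independently of \<open>w\<close>.\<close>

lemma negligible_avoiding:
  assumes b: "b \<in> lists (digits \<beta>)"
  shows "negligible (avoiding b)"
proof (rule negligible_if_porous[where c = "1 / \<beta> ^ length b"])
  have "avoiding b = expansion_interval \<beta> -
      (\<Union>w\<in>lists (digits \<beta>). {x. orbit \<beta> x (w @ b) \<in> expansion_interval \<beta>})"
    by (auto simp: avoiding_def)
  also have "\<dots> \<in> sets lebesgue"
    unfolding cylinder_eq_cball
    by (intro sets.Diff sets.countable_UN' countable_lists_digits)
      (auto simp: expansion_interval_def)
  finally show "avoiding b \<in> sets lebesgue" .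
next
  show "0 < 1 / \<beta> ^ length b" using \<beta> by simp
next
  fix x e :: real assume x: "x \<in> avoiding b" and "0 < e"
  then obtain n where n: "len / 2 / \<beta> ^ n < e" using exists_small_scale by blast
  obtain w where w: "w \<in> lists (digits \<beta>)" "length w = n" "orbit \<beta> x w \<in> expansion_interval \<beta>"
    using exists_orbit_word x unfolding avoiding_def by blast
  let ?cyl = "\<lambda>w. {y. orbit \<beta> y w \<in> expansion_interval \<beta>}"
  have "?cyl (w @ b) \<subseteq> ?cyl w - avoiding b"
    using orbit_prefix_mem[OF b] w(1) by (auto simp: orbit_append avoiding_def)
  moreover have "ennreal (1 / \<beta> ^ length b) * emeasure lebesgue (?cyl w)
      \<le> emeasure lebesgue (?cyl (w @ b))"
    unfolding emeasure_cylinder using \<beta> len_gt_1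
    by (simp add: ennreal_mult[symmetric] power_add mult.commute)
  moreover have "?cyl (w @ b) \<in> sets lebesgue" by (simp add: cylinder_eq_cball)
  moreover have "0 < len / 2 / \<beta> ^ n" using \<beta> len_gt_1 by simp
  moreover have "x \<in> ?cyl w" using w by simp
  ultimately show "\<exists>a r G. 0 < r \<and> r < e \<and> x \<in> cball a r \<and> G \<in> sets lebesgue \<and>
      G \<subseteq> cball a r - avoiding b \<and>
      ennreal (1 / \<beta> ^ length b) * emeasure lebesgue (cball a r) \<le> emeasure lebesgue G"
    unfolding cylinder_eq_cball[of w] w(2) using n by blast
qed

text \<open>The preimage lies in the image of \<open>Z\<close> under the inverse affine map
  \<open>?f\<close>, which is differentiable and so preserves null sets.\<close>

lemma negligible_orbit_vimage:
  assumes "negligible Z"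
  shows "negligible {x. orbit \<beta> x v \<in> Z}"
proof -
  let ?f = "\<lambda>y. (y - orbit \<beta> 0 v) / \<beta> ^ length v"
  have "negligible (?f ` Z)"
    using \<beta> assms
    by (intro negligible_differentiable_image_negligible) (auto simp: differentiable_on_def intro!: derivative_intros)
  moreover have "{x. orbit \<beta> x v \<in> Z} \<subseteq> ?f ` Z"
  proof
    fix x assume "x \<in> {x. orbit \<beta> x v \<in> Z}"
    moreover have "x = ?f (orbit \<beta> x v)"
      using \<beta> by (simp add: orbit_affine[of \<beta> x v])
    ultimately show "x \<in> ?f ` Z" by blast
  qed
  ultimately show ?thesis by (rule negligible_subset)
qed

text \<open>A failure of richness is witnessed by one word \<open>v\<close> and one block
  \<open>b\<close>, and there are only countably many such pairs.\<close>

lemma negligible_not_rich: "negligible {x \<in> expansion_interval \<beta>. \<not> rich \<beta> x}"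
proof (rule negligible_subset)
  show "negligible (\<Union>v\<in>lists (digits \<beta>). \<Union>b\<in>lists (digits \<beta>). {x. orbit \<beta> x v \<in> avoiding b})"
    using negligible_orbit_vimage negligible_avoiding
    by (intro negligible_countable_Union[OF countable_image[OF countable_lists_digits]])
      (auto intro!: negligible_countable_Union[OF countable_image[OF countable_lists_digits]])
  show "{x \<in> expansion_interval \<beta>. \<not> rich \<beta> x} \<subseteq>
      (\<Union>v\<in>lists (digits \<beta>). \<Union>b\<in>lists (digits \<beta>). {x. orbit \<beta> x v \<in> avoiding b})"
  proof
    fix x assume "x \<in> {x \<in> expansion_interval \<beta>. \<not> rich \<beta> x}"
    then obtain v b where "v \<in> lists (digits \<beta>)" "b \<in> lists (digits \<beta>)"
      "orbit \<beta> x v \<in> avoiding b"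
      unfolding rich_def avoiding_def by (auto simp: orbit_append)
    then show "x \<in> (\<Union>v\<in>lists (digits \<beta>). \<Union>b\<in>lists (digits \<beta>). {x. orbit \<beta> x v \<in> avoiding b})"
      by blast
  qed
qed

section \<open>Steering to a free binary choice\<close>

text \<open>Digits 0 and 1 are both possible exactly when
  \<open>1 \<le> \<beta> * y \<le> len\<close>, a nondegenerate interval of \<open>y\<close> with
  midpoint \<open>z\<close>. A long admissible word at \<open>z\<close> has a cylinder short enough
  to lie inside it. Reaching this interval thus becomes a matter of reaching a block.\<close>

lemma exists_switch_word:
  "\<exists>s\<in>lists (digits \<beta>). \<forall>y. orbit \<beta> y s \<in> expansion_interval \<beta> \<longrightarrow>
     orbit \<beta> y [0] \<in> expansion_interval \<beta> \<and> orbit \<beta> y [1] \<in> expansion_interval \<beta>"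
proof -
  define z where "z = (1 + len) / (2 * \<beta>)"
  have \<beta>z: "\<beta> * z = (1 + len) / 2" using \<beta> by (simp add: z_def)
  then have "orbit \<beta> z [0] \<in> expansion_interval \<beta>"
    using len_gt_1 by (simp add: expansion_interval_eq)
  then have z: "z \<in> expansion_interval \<beta>"
    using orbit_prefix_mem[of "[0]" z] digits_0_1 by simp
  \<comment> \<open>Points of one cylinder differ by at most \<open>len / \<beta> ^ n\<close>; after
    multiplication by \<beta> this has to stay below half the length of
    \<open>{1..len}\<close>.\<close>
  obtain n where n: "\<beta> * len / \<beta> ^ n < (len - 1) / 2"
    using exists_small_scale[of "(len - 1) / 2"] len_gt_1 by auto
  obtain s where s: "s \<in> lists (digits \<beta>)" "length s = n" "orbit \<beta> z s \<in> expansion_interval \<beta>"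
    using exists_orbit_word[OF z] by blast
  have "orbit \<beta> y [0] \<in> expansion_interval \<beta> \<and> orbit \<beta> y [1] \<in> expansion_interval \<beta>"
    if y: "orbit \<beta> y s \<in> expansion_interval \<beta>" for y
  proof -
    have "\<beta> ^ n * (y - z) = orbit \<beta> y s - orbit \<beta> z s"
      by (simp add: orbit_affine[of \<beta> y s] orbit_affine[of \<beta> z s] s(2) algebra_simps)
    then have "\<bar>\<beta> ^ n * (y - z)\<bar> \<le> len"
      using y s(3) by (auto simp: expansion_interval_eq)
    then have "\<bar>y - z\<bar> \<le> len / \<beta> ^ n"
      using \<beta> by (simp add: abs_mult pos_le_divide_eq mult.commute)
    then have "\<beta> * \<bar>y - z\<bar> \<le> \<beta> * (len / \<beta> ^ n)"
      using \<beta> by (intro mult_left_mono) auto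
    also have "\<dots> \<le> (len - 1) / 2" using n by simp
    finally have "\<bar>\<beta> * (y - z)\<bar> \<le> (len - 1) / 2" using \<beta> by (simp add: abs_mult)
    then have "\<bar>\<beta> * y - (1 + len) / 2\<bar> \<le> (len - 1) / 2"
      by (simp only: right_diff_distrib \<beta>z)
    then have "1 \<le> \<beta> * y" "\<beta> * y \<le> len" by (auto simp: abs_le_iff field_simps)
    then show ?thesis by (simp add: expansion_interval_eq)
  qed
  with s(1) show ?thesis by blast
qed

text \<open>Richness is used twice, to reach \<open>b\<close> and then to reach the switch word
  \<open>s\<close>. The word \<open>s\<close> itself is not read: that it could follow
  \<open>v\<close> already makes both digits admissible there.\<close>

lemma rich_branch:
  assumes x: "rich \<beta> x" and b: "b \<in> lists (digits \<beta>)"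
  shows "\<exists>u\<in>lists (digits \<beta>). \<exists>v\<in>lists (digits \<beta>).
    rich \<beta> (orbit \<beta> x (u @ b @ v @ [0])) \<and> rich \<beta> (orbit \<beta> x (u @ b @ v @ [1]))"
proof -
  obtain s where s: "s \<in> lists (digits \<beta>)"
    "\<And>y. orbit \<beta> y s \<in> expansion_interval \<beta> \<Longrightarrow>
       orbit \<beta> y [0] \<in> expansion_interval \<beta> \<and> orbit \<beta> y [1] \<in> expansion_interval \<beta>"
    using exists_switch_word by blast
  have "x \<in> expansion_interval \<beta>" using x by (simp add: rich_def)
  then obtain u where u: "u \<in> lists (digits \<beta>)" "orbit \<beta> x (u @ b) \<in> expansion_interval \<beta>"
    using x b unfolding rich_def by (metis append_Nil lists.Nil orbit_Nil)
  then obtain v where v: "v \<in> lists (digits \<beta>)"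
    "orbit \<beta> x ((u @ b) @ v @ s) \<in> expansion_interval \<beta>"
    using x b s(1) unfolding rich_def by (metis append_in_lists_conv)
  have "rich \<beta> (orbit \<beta> x (u @ b @ v @ [e]))" if "e \<in> {0, 1}" for e
  proof (rule rich_orbit[OF x])
    show "u @ b @ v @ [e] \<in> lists (digits \<beta>)"
      using that digits_0_1 u v b by auto
    show "orbit \<beta> x (u @ b @ v @ [e]) \<in> expansion_interval \<beta>"
      using that s(2)[of "orbit \<beta> x (u @ b @ v)"] v(2) by (auto simp: orbit_append)
  qed
  with u v show ?thesis by blast
qed

section \<open>Counting universal expansions of rich points\<close>

text \<open>Partial sums miss \<open>x\<close> by the orbit point divided by
  \<open>\<beta> ^ n\<close>, which tends to 0 because the orbit stays bounded. Lengths between the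
  given ones are covered by \<open>orbit_prefix_mem\<close>.\<close>

lemma is_expansion_if_orbit_mem:
  assumes "\<And>n. \<exists>m\<ge>n. map d [0..<m] \<in> lists (digits \<beta>) \<and>
    orbit \<beta> x (map d [0..<m]) \<in> expansion_interval \<beta>"
  shows "is_expansion \<beta> x d"
proof -
  have digit: "d i \<in> digits \<beta>" for i
    using assms[of "Suc i"] by (auto simp: in_lists_conv_set)
  have mem: "orbit \<beta> x (map d [0..<n]) \<in> {0..len}" for n
  proof -
    obtain m where m: "m \<ge> n" "orbit \<beta> x (map d [0..<m]) \<in> expansion_interval \<beta>"
      using assms by blast
    have "map d [0..<m] = map d [0..<n] @ map d [n..<m]"
      using m(1) by (metis le_add_diff_inverse map_append upt_add_eq_append zero_le)
    then have "orbit \<beta> (orbit \<beta> x (map d [0..<n])) (map d [n..<m]) \<in> expansion_interval \<beta>"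
      using m(2) by (simp add: orbit_append)
    moreover have "map d [n..<m] \<in> lists (digits \<beta>)" using digit by auto
    ultimately show ?thesis using orbit_prefix_mem expansion_interval_eq by blast
  qed
  have "(\<lambda>n. len / \<beta> ^ n) \<longlonglongrightarrow> 0"
    using tendsto_mult_right_zero[OF LIMSEQ_inverse_realpow_zero[OF \<beta>], of len]
    by (simp add: divide_inverse)
  then have "(\<lambda>n. orbit \<beta> x (map d [0..<n]) / \<beta> ^ n) \<longlonglongrightarrow> 0"
    by (rule Lim_null_comparison[rotated])
      (use mem \<beta> in \<open>auto simp: divide_right_mono\<close>)
  then have "(\<lambda>n. x - orbit \<beta> x (map d [0..<n]) / \<beta> ^ n) \<longlonglongrightarrow> x - 0"
    by (intro tendsto_diff tendsto_const)
  then have "(\<lambda>i. of_int (d i) / \<beta> ^ (i + 1)) sums x"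
    using \<beta> unfolding sums_def by (subst orbit_map_upt[where x = x]) auto
  then show ?thesis
    using digit unfolding is_expansion_def by blast
qed

text \<open>The upper bound counts all integer sequences. The lower bound feeds
  \<open>rich_branch\<close> into \<open>branching_words_lepoll\<close>, the good words being the
  digit words that lead to rich points.\<close>

lemma universal_expansions_if_rich:
  assumes x: "rich \<beta> x"
  shows "{d. is_expansion \<beta> x d \<and> universal \<beta> d} \<approx> (UNIV :: nat set set)"
proof (rule lepoll_antisym)
  show "{d. is_expansion \<beta> x d \<and> universal \<beta> d} \<lesssim> (UNIV :: nat set set)"
    using lepoll_trans[OF subset_imp_lepoll[OF subset_UNIV] nat_fun_lepoll_nat_sets] .
next
  define good where "good w \<longleftrightarrow> w \<in> lists (digits \<beta>) \<and> rich \<beta> (orbit \<beta> x w)" for w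
  have "(UNIV :: nat set set) \<lesssim>
    {d. (\<forall>n. \<exists>m\<ge>n. good (map d [0..<m])) \<and>
        (\<forall>b. set b \<subseteq> digits \<beta> \<longrightarrow> (\<exists>k. \<forall>j<length b. d (k + j) = b ! j))}"
    (is "_ \<lesssim> ?E")
  proof (rule branching_words_lepoll)
    show "(0::int) \<noteq> 1" "good []" using x by (simp_all add: good_def)
  next
    fix w b assume w: "good w" and b: "set b \<subseteq> digits \<beta>"
    then have "b \<in> lists (digits \<beta>)" "rich \<beta> (orbit \<beta> x w)"
      by (auto simp: good_def)
    then obtain u v where "u \<in> lists (digits \<beta>)" "v \<in> lists (digits \<beta>)"
      "rich \<beta> (orbit \<beta> (orbit \<beta> x w) (u @ b @ v @ [0]))"
      "rich \<beta> (orbit \<beta> (orbit \<beta> x w) (u @ b @ v @ [1]))"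
      using rich_branch by blast
    with w b digits_0_1
    show "\<exists>u v. good (w @ u @ b @ v @ [0]) \<and> good (w @ u @ b @ v @ [1])"
      by (intro exI[of _ u] exI[of _ v]) (auto simp: good_def orbit_append)
  qed
  also have "\<dots> \<lesssim> {d. is_expansion \<beta> x d \<and> universal \<beta> d}"
  proof (intro subset_imp_lepoll subsetI CollectI conjI)
    fix d assume d: "d \<in> ?E"
    show "is_expansion \<beta> x d"
    proof (rule is_expansion_if_orbit_mem)
      fix n
      obtain m where "m \<ge> n" "good (map d [0..<m])" using d by blast
      then show "\<exists>m\<ge>n. map d [0..<m] \<in> lists (digits \<beta>) \<and>
          orbit \<beta> x (map d [0..<m]) \<in> expansion_interval \<beta>"
        unfolding good_def rich_def by blast
    qed
    show "universal \<beta> d" using d by (simp add: universal_def)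
  qed
  finally show "(UNIV :: nat set set) \<lesssim> {d. is_expansion \<beta> x d \<and> universal \<beta> d}" .
qed

section \<open>Passage to the normalized Lebesgue measure\<close>

lemma AE_rich: "AE x in normalized_lebesgue \<beta>. rich \<beta> x"
proof -
  have m: "expansion_interval \<beta> \<in> sets lebesgue" by (simp add: expansion_interval_def)
  have "AE x in lebesgue. x \<in> expansion_interval \<beta> \<longrightarrow> rich \<beta> x"
    using negligible_not_rich
    by (intro AE_I'[of "{x \<in> expansion_interval \<beta>. \<not> rich \<beta> x}"]) (auto simp: negligible_iff_null_sets)
  then have "AE x in lebesgue_on (expansion_interval \<beta>). rich \<beta> x"
    using m by (simp add: AE_restrict_space_iff)
  then show ?thesis
    unfolding normalized_lebesgue_def using m
    by (intro AE_uniform_measureI) (auto simp: sets_restrict_space)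
qed

end

theorem theorem7:
  fixes \<beta> :: real
  assumes "\<beta> > 1" and "\<beta> \<notin> \<int>"
  shows "AE x in normalized_lebesgue \<beta>.
           {d. is_expansion \<beta> x d \<and> universal \<beta> d} \<approx> (UNIV :: nat set set)"
  using AE_rich[OF assms(1)] by eventually_elim (rule universal_expansions_if_rich[OF assms(1)])

end
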